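(* For the problem of scheduling with uncertain processing times on a single machine with the objective of minimizing the total completion time, the algorithm $(\alpha,\beta)$-SORT with $\alpha=\beta=\sqrt2$ is $(1+\sqrt2)$-competitive. Moreover, this choice of $\alpha$ and $\beta$ is optimal for the expression $$\max\left\{\alpha\left(1+\tfrac1\beta\right),\ 1+\tfrac1\alpha+\tfrac1\beta,\ 1+\beta,\ 2,\ 1+\tfrac2\alpha\right\},$$ i.e. it minimizes this expression over all choices of the parameters $\alpha,\beta\ge1$.
   Context: Problem. There are $n$ jobs, all available at time $0$. Job $j$ has a testing time $t_j\ge 0$, an upper limit $u_j\ge 0$, and a real processing time $p_j\in[0,u_j]$. A job may be executed untested, which takes $u_j$ time units, or it may be tested (taking $t_j$ time units) and later executed in $p_j$ time units; other tasks may run between the test and the execution. A single machine runs one task at a time. The completion time of a job is the time at which its execution (or execution-untested) ends, and the cost of a schedule is the sum of the completion times of all jobs. An online algorithm knows all $t_j,u_j$ from the start, but learns $p_j$ only when the test of $j$ is finished. $\mathrm{OPT}$ knows all $p_j$ in advance (but must still test $j$ in order to run it in time $p_j$), and its cost is the minimum cost of any schedule. An algorithm $A$ is $c$-competitive if $\mathrm{cost}(A)\le c\cdot \mathrm{cost}(\mathrm{OPT})$ on all instances. Algorithm $(\alpha,\beta)$-SORT. Maintain a priority queue of tasks, smaller weight meaning higher priority (ties broken arbitrarily). Initially, for each job $j$: if $u_j\ge\alpha t_j$, insert a testing task of weight $\beta t_j$; otherwise insert an execution-untested task of weight $u_j$. While the queue is nonempty, extract a task of smallest weight and run it; if it was the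 testing task of job $j$, then after the test insert an execution task for $j$ with weight $p_j$. *)

theory Defs
  imports Complex_Main
begin

record sched_instance =
  njobs :: nat
  ttime :: "nat \<Rightarrow> real"
  ulim :: "nat \<Rightarrow> real"
  ptime :: "nat \<Rightarrow> real"

definition valid_instance :: "sched_instance \<Rightarrow> bool" where
  "valid_instance I \<longleftrightarrow>
     (\<forall>j<njobs I. 0 \<le> ttime I j \<and> 0 \<le> ulim I j \<and> 0 \<le> ptime I j \<and> ptime I j \<le> ulim I j)"

datatype task = Test (job: nat) | Exec (job: nat) | Untested (job: nat)

fun duration :: "sched_instance \<Rightarrow> task \<Rightarrow> real" where
  "duration I (Test j) = ttime I j"
| "duration I (Exec j) = ptime I j"
| "duration I (Untested j) = ulim I j"

text \<open>A schedule maps every task that is run to its starting time. Tasks are run without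
  preemption; the machine may idle.\<close>

type_synonym schedule = "task \<Rightarrow> real option"

definition feasible :: "sched_instance \<Rightarrow> schedule \<Rightarrow> bool" where
  "feasible I S \<longleftrightarrow>
     (\<forall>x\<in>dom S. job x < njobs I \<and> 0 \<le> the (S x)) \<and>
     (\<forall>j<njobs I. {x \<in> dom S. job x = j} = {Untested j} \<or>
                  {x \<in> dom S. job x = j} = {Test j, Exec j}) \<and>
     (\<forall>j. Test j \<in> dom S \<longrightarrow> the (S (Test j)) + ttime I j \<le> the (S (Exec j))) \<and>
     (\<forall>x\<in>dom S. \<forall>y\<in>dom S. x \<noteq> y \<longrightarrow>
        the (S x) + duration I x \<le> the (S y) \<or> the (S y) + duration I y \<le> the (S x))"

definition completion :: "sched_instance \<Rightarrow> schedule \<Rightarrow> nat \<Rightarrow> real" where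
  "completion I S j =
     (case S (Exec j) of Some s \<Rightarrow> s + ptime I j
                       | None \<Rightarrow> the (S (Untested j)) + ulim I j)"

definition cost :: "sched_instance \<Rightarrow> schedule \<Rightarrow> real" where
  "cost I S = (\<Sum>j<njobs I. completion I S j)"

definition opt_cost :: "sched_instance \<Rightarrow> real" where
  "opt_cost I = Inf (cost I ` {S. feasible I S})"

text \<open>An algorithm with unspecified choices (here: tie breaking) is given by the set of schedules
  it may produce on an instance; the guarantee has to hold for all of them.\<close>

definition competitive :: "(sched_instance \<Rightarrow> schedule set) \<Rightarrow> real \<Rightarrow> bool" where
  "competitive A c \<longleftrightarrow>
     (\<forall>I. valid_instance I \<longrightarrow> (\<forall>S\<in>A I. cost I S \<le> c * opt_cost I))"

fun weight :: "real \<Rightarrow> sched_instance \<Rightarrow> task \<Rightarrow> real" where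
  "weight \<beta> I (Test j) = \<beta> * ttime I j"
| "weight \<beta> I (Exec j) = ptime I j"
| "weight \<beta> I (Untested j) = ulim I j"

definition init_queue :: "real \<Rightarrow> sched_instance \<Rightarrow> task set" where
  "init_queue \<alpha> I =
     (\<lambda>j. if ulim I j \<ge> \<alpha> * ttime I j then Test j else Untested j) ` {..<njobs I}"

fun released :: "task \<Rightarrow> task set" where
  "released (Test j) = {Exec j}"
| "released (Exec j) = {}"
| "released (Untested j) = {}"

text \<open>\<open>sort_run \<beta> I Q xs\<close>: starting from queue content \<open>Q\<close>, the tasks may be extracted
  in the order \<open>xs\<close> until the queue is empty.\<close>

inductive sort_run :: "real \<Rightarrow> sched_instance \<Rightarrow> task set \<Rightarrow> task list \<Rightarrow> bool"
  for \<beta> :: real and I :: sched_instance where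
  finish: "sort_run \<beta> I {} []"
| take_min: "x \<in> Q \<Longrightarrow> (\<And>y. y \<in> Q \<Longrightarrow> weight \<beta> I x \<le> weight \<beta> I y) \<Longrightarrow>
    sort_run \<beta> I (Q - {x} \<union> released x) xs \<Longrightarrow> sort_run \<beta> I Q (x # xs)"

fun seq_schedule :: "sched_instance \<Rightarrow> real \<Rightarrow> task list \<Rightarrow> schedule" where
  "seq_schedule I s [] = Map.empty"
| "seq_schedule I s (x # xs) = (seq_schedule I (s + duration I x) xs)(x \<mapsto> s)"

definition SORT :: "real \<Rightarrow> real \<Rightarrow> sched_instance \<Rightarrow> schedule set" where
  "SORT \<alpha> \<beta> I = {seq_schedule I 0 xs | xs. sort_run \<beta> I (init_queue \<alpha> I) xs}"

definition sort_bound :: "real \<Rightarrow> real \<Rightarrow> real" where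
  "sort_bound \<alpha> \<beta> =
     Max {\<alpha> * (1 + 1 / \<beta>), 1 + 1 / \<alpha> + 1 / \<beta>, 1 + \<beta>, 2, 1 + 2 / \<alpha>}"

text \<open>Consistency of the model: every run of the algorithm yields a feasible schedule, some run
  exists, and the infimum in \<^const>\<open>opt_cost\<close> is taken over a nonempty set of reals bounded below.\<close>

lemma dom_seq_schedule: "dom (seq_schedule I s xs) = set xs"
  by (induction xs arbitrary: s) auto

lemma seq_schedule_ge:
  assumes "\<And>x. x \<in> set xs \<Longrightarrow> 0 \<le> duration I x" "y \<in> set xs"
  shows "s \<le> the (seq_schedule I s xs y)"
  using assms
proof (induction xs arbitrary: s)
  case (Cons x xs)
  have "0 \<le> duration I x" using Cons.prems by simp
  moreover have "s + duration I x \<le> the (seq_schedule I (s + duration I x) xs y)" if "y \<noteq> x"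
    using Cons that by (intro Cons.IH) auto
  ultimately show ?case by auto
qed simp

lemma seq_schedule_disjoint:
  assumes "distinct xs" "\<And>x. x \<in> set xs \<Longrightarrow> 0 \<le> duration I x"
    "x \<in> set xs" "y \<in> set xs" "x \<noteq> y"
  shows "the (seq_schedule I s xs x) + duration I x \<le> the (seq_schedule I s xs y) \<or>
         the (seq_schedule I s xs y) + duration I y \<le> the (seq_schedule I s xs x)"
  using assms
proof (induction xs arbitrary: s)
  case (Cons z zs)
  have ge: "s + duration I z \<le> the (seq_schedule I (s + duration I z) zs w)" if "w \<in> set zs" for w
    using Cons.prems that by (intro seq_schedule_ge) auto
  consider "x = z" "y \<in> set zs" | "y = z" "x \<in> set zs" | "x \<noteq> z" "y \<noteq> z" "x \<in> set zs" "y \<in> set zs"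
    using Cons.prems by auto
  then show ?case
  proof cases
    case 3
    then have "the (seq_schedule I (s + duration I z) zs x) + duration I x
        \<le> the (seq_schedule I (s + duration I z) zs y) \<or>
      the (seq_schedule I (s + duration I z) zs y) + duration I y
        \<le> the (seq_schedule I (s + duration I z) zs x)"
      using Cons.prems by (intro Cons.IH) auto
    with 3 show ?thesis by simp
  qed (use ge Cons.prems in auto)
qed simp

lemma sort_run_tasks:
  assumes "sort_run \<beta> I Q xs" "\<And>j. Test j \<in> Q \<Longrightarrow> Exec j \<notin> Q"
  shows "distinct xs \<and> set xs = Q \<union> Exec ` {j. Test j \<in> Q}"
  using assms
proof (induction rule: sort_run.induct)
  case (take_min x Q xs)
  have "distinct xs \<and> set xs = (Q - {x} \<union> released x) \<union> Exec ` {j. Test j \<in> Q - {x} \<union> released x}"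
    using take_min.hyps(1) take_min.prems by (intro take_min.IH) (cases x; auto)
  with take_min.hyps(1) take_min.prems show ?case by (cases x) auto
qed auto

lemma sort_run_precedence:
  assumes "sort_run \<beta> I Q xs" "\<And>j. Test j \<in> Q \<Longrightarrow> Exec j \<notin> Q" "Test j \<in> Q"
    "\<And>x. x \<in> set xs \<Longrightarrow> 0 \<le> duration I x"
  shows "the (seq_schedule I s xs (Test j)) + ttime I j \<le> the (seq_schedule I s xs (Exec j))"
  using assms
proof (induction arbitrary: s rule: sort_run.induct)
  case (take_min x Q xs)
  let ?Q = "Q - {x} \<union> released x"
  have wf: "Exec k \<notin> ?Q" if "Test k \<in> ?Q" for k
    using take_min.prems(1)[of k] that by (cases x) auto
  have set_xs: "set xs = ?Q \<union> Exec ` {k. Test k \<in> ?Q}"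
    using sort_run_tasks[OF take_min.hyps(3)] wf by blast
  have neq: "x \<noteq> Exec j" using take_min.hyps(1) take_min.prems by auto
  show ?case
  proof (cases "x = Test j")
    case True
    then have "Exec j \<in> set xs" using set_xs by auto
    then have "s + duration I x \<le> the (seq_schedule I (s + duration I x) xs (Exec j))"
      using take_min.prems by (intro seq_schedule_ge) auto
    with True show ?thesis by simp
  next
    case False
    then have "the (seq_schedule I (s + duration I x) xs (Test j)) + ttime I j
      \<le> the (seq_schedule I (s + duration I x) xs (Exec j))"
      using take_min.prems wf by (intro take_min.IH) auto
    with False neq show ?thesis by simp
  qed
qed simp

lemma SORT_feasible:
  assumes "valid_instance I" "S \<in> SORT \<alpha> \<beta> I"
  shows "feasible I S"
proof -
  let ?Q = "init_queue \<alpha> I"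
  obtain xs where S: "S = seq_schedule I 0 xs" and run: "sort_run \<beta> I ?Q xs"
    using assms(2) unfolding SORT_def by auto
  have wf: "\<And>j. Test j \<in> ?Q \<Longrightarrow> Exec j \<notin> ?Q"
    unfolding init_queue_def by (auto split: if_splits)
  have d: "distinct xs" and set_xs: "set xs = ?Q \<union> Exec ` {j. Test j \<in> ?Q}"
    using sort_run_tasks[OF run wf] by auto
  have dom: "dom S = set xs" unfolding S by (rule dom_seq_schedule)
  have job: "job x < njobs I" if "x \<in> set xs" for x
    using that unfolding set_xs init_queue_def by (auto split: if_splits)
  have nonneg: "0 \<le> duration I x" if "x \<in> set xs" for x
    using job[OF that] assms(1) unfolding valid_instance_def by (cases x) auto
  have "{x \<in> set xs. job x = j} = {Untested j} \<or> {x \<in> set xs. job x = j} = {Test j, Exec j}"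
    if "j < njobs I" for j
    using that unfolding set_xs init_queue_def
    by (cases "ulim I j \<ge> \<alpha> * ttime I j") (auto split: if_splits)
  moreover have "the (S (Test j)) + ttime I j \<le> the (S (Exec j))" if "Test j \<in> set xs" for j
    using that unfolding S set_xs by (intro sort_run_precedence[OF run wf _ nonneg]) auto
  moreover have "0 \<le> the (S x)" if "x \<in> set xs" for x
    using that nonneg unfolding S by (intro seq_schedule_ge) auto
  moreover have "the (S x) + duration I x \<le> the (S y) \<or> the (S y) + duration I y \<le> the (S x)"
    if "x \<in> set xs" "y \<in> set xs" "x \<noteq> y" for x y
    using that d nonneg unfolding S by (intro seq_schedule_disjoint) auto
  ultimately show ?thesis
    unfolding feasible_def dom using job by blast
qed

lemma sort_run_exists:
  assumes "finite Q"
  shows "\<exists>xs. sort_run \<beta> I Q xs"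
  using assms
proof (induction "card Q + card {j. Test j \<in> Q}" arbitrary: Q rule: less_induct)
  case less
  show ?case
  proof (cases "Q = {}")
    case True
    then show ?thesis using sort_run.finish by auto
  next
    case False
    obtain x where x: "x \<in> Q" "\<And>y. y \<in> Q \<Longrightarrow> weight \<beta> I x \<le> weight \<beta> I y"
      using arg_min_if_finite[OF less.prems False, of "weight \<beta> I"] by (meson linorder_not_less)
    let ?Q = "Q - {x} \<union> released x"
    have fin: "finite ?Q" using less.prems by (cases x) auto
    have fT: "finite {j. Test j \<in> Q}"
      using finite_vimageI[of Q Test] less.prems by (simp add: vimage_def inj_def)
    have cQ: "card (Q - {x}) < card Q" using x(1) less.prems by (rule card_Diff1_less[rotated])
    have "card ?Q + card {j. Test j \<in> ?Q} < card Q + card {j. Test j \<in> Q}"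
    proof (cases x)
      case (Test j)
      have "card ?Q \<le> card Q"
        using cQ less.prems Test card_insert_le_m1[of "card Q" "Q - {x}" "Exec j"] by auto
      moreover have "{k. Test k \<in> ?Q} \<subset> {k. Test k \<in> Q}"
        using Test x(1) by (auto simp: psubset_eq)
      ultimately show ?thesis by (intro add_le_less_mono psubset_card_mono[OF fT])
    next
      case (Exec j)
      then have "{k. Test k \<in> ?Q} = {k. Test k \<in> Q}" by auto
      with cQ Exec show ?thesis by simp
    next
      case (Untested j)
      then have "{k. Test k \<in> ?Q} = {k. Test k \<in> Q}" by auto
      with cQ Untested show ?thesis by simp
    qed
    from less.hyps[OF this fin] show ?thesis using sort_run.take_min x by blast
  qed
qed

lemma SORT_nonempty: "SORT \<alpha> \<beta> I \<noteq> {}"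
  using sort_run_exists[of "init_queue \<alpha> I" \<beta> I] unfolding SORT_def init_queue_def by auto

lemma completion_nonneg:
  assumes "valid_instance I" "feasible I S" "j < njobs I"
  shows "0 \<le> completion I S j"
proof -
  have p: "0 \<le> ptime I j" "0 \<le> ulim I j" using assms unfolding valid_instance_def by auto
  have ge: "\<And>x. x \<in> dom S \<Longrightarrow> 0 \<le> the (S x)" using assms(2) unfolding feasible_def by blast
  have "{x \<in> dom S. job x = j} = {Untested j} \<or> {x \<in> dom S. job x = j} = {Test j, Exec j}"
    using assms unfolding feasible_def by blast
  then have "Untested j \<in> dom S \<or> Exec j \<in> dom S" by blast
  then show ?thesis
    using p ge[of "Exec j"] ge[of "Untested j"] unfolding completion_def
    by (auto simp: domIff split: option.split)
qed

lemma feasible_costs: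
  assumes "valid_instance I"
  shows "cost I ` {S. feasible I S} \<noteq> {}" "bdd_below (cost I ` {S. feasible I S})"
proof -
  show "cost I ` {S. feasible I S} \<noteq> {}"
    using SORT_nonempty[of 1 1 I] SORT_feasible[OF assms] by auto
  show "bdd_below (cost I ` {S. feasible I S})"
    by (rule bdd_belowI[of _ 0])
      (auto simp: cost_def intro!: sum_nonneg completion_nonneg[OF assms])
qed

end

theory Submission
  imports Defs
begin

text \<open>Both costs are split into contributions of ordered pairs of jobs. Let
  \<open>q\<^sub>j = min u\<^sub>j (t\<^sub>j + p\<^sub>j)\<close>. In any feasible schedule, the job of each pair that completes first
  delays the other one by at least its \<open>q\<close>, so the pair \<open>i, j\<close> contributes at least
  \<open>min q\<^sub>i q\<^sub>j\<close>. In a run of SORT, whenever a task is extracted while another one is in the queue,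
  their weights are ordered; running through the possible orders of the at most four tasks of a
  pair, its mutual delay is at most \<^const>\<open>sort_bound\<close> times \<open>min q\<^sub>i q\<^sub>j\<close>.\<close>

section \<open>Lower bound on completion times in an arbitrary feasible schedule\<close>

definition opt_time :: "sched_instance \<Rightarrow> nat \<Rightarrow> real" where
  "opt_time I j = min (ulim I j) (ttime I j + ptime I j)"

text \<open>Induction on the set, removing the interval \<open>x\<close> that ends last: the
  intervals ending by \<open>s x\<close> fit below \<open>s x\<close> by induction, and all others
  have length zero.\<close>

lemma sum_disjoint_intervals_le:
  fixes s d :: "'a \<Rightarrow> real"
  assumes "finite X" "0 \<le> T"
    and "\<And>x. x \<in> X \<Longrightarrow> 0 \<le> s x" "\<And>x. x \<in> X \<Longrightarrow> 0 \<le> d x" "\<And>x. x \<in> X \<Longrightarrow> s x + d x \<le> T"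
    and "\<And>x y. x \<in> X \<Longrightarrow> y \<in> X \<Longrightarrow> x \<noteq> y \<Longrightarrow> s x + d x \<le> s y \<or> s y + d y \<le> s x"
  shows "sum d X \<le> T"
  using assms
proof (induction X arbitrary: T rule: finite_psubset_induct)
  case (psubset X)
  show ?case
  proof (cases "X = {}")
    case False
    obtain x where x: "x \<in> X" and x_max: "\<And>y. y \<in> X \<Longrightarrow> s y + d y \<le> s x + d x"
      using arg_min_if_finite[OF psubset.hyps(1) False, of "\<lambda>x. - (s x + d x)"]
      by (meson neg_less_iff_less not_le)
    define Y where "Y = {y \<in> X - {x}. s y + d y \<le> s x}"
    \<comment> \<open>Such a \<open>y\<close> does not end by \<open>s x\<close>, so it starts no
      earlier than the end of \<open>x\<close>; it also ends no later than \<open>x\<close>.\<close>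
    have "d y = 0" if "y \<in> X - {x} - Y" for y
      using that psubset.prems(3)[of y] psubset.prems(5)[of x y] x x_max[of y] unfolding Y_def by fastforce
    then have "sum d (X - {x}) = sum d Y"
      using psubset.hyps(1) by (intro sum.mono_neutral_right) (auto simp: Y_def)
    moreover have "sum d Y \<le> s x"
      using x psubset.prems unfolding Y_def by (intro psubset.IH) auto
    ultimately show ?thesis
      using psubset.prems(4)[OF x] sum.remove[OF psubset.hyps(1) x, of d] by simp
  qed (use psubset.prems in simp)
qed

text \<open>All tasks of the jobs completed by the completion time of \<open>j\<close> are disjoint
  intervals inside \<open>[0, completion I S j]\<close>. Each of these jobs occupies the machine for
  \<open>ulim I i\<close> or for \<open>ttime I i + ptime I i\<close>, hence for at least
  \<open>opt_time I i\<close>.\<close>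

lemma sum_opt_time_le_completion:
  assumes "valid_instance I" "feasible I S" "j < njobs I"
  shows "(\<Sum>i<njobs I. if completion I S i \<le> completion I S j then opt_time I i else 0)
    \<le> completion I S j"
proof -
  let ?C = "completion I S"
  define X where "X = {x \<in> dom S. ?C (job x) \<le> ?C j}"
  define J where "J = {i. i < njobs I \<and> ?C i \<le> ?C j}"
  have job: "job x < njobs I" and start: "0 \<le> the (S x)" if "x \<in> dom S" for x
    using assms(2) that unfolding feasible_def by blast+
  have tasks: "{x \<in> dom S. job x = i} = {Untested i} \<or> {x \<in> dom S. job x = i} = {Test i, Exec i}"
    if "i < njobs I" for i
    using assms(2) that unfolding feasible_def by blast
  have prec: "the (S (Test i)) + ttime I i \<le> the (S (Exec i))" if "Test i \<in> dom S" for i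
    using assms(2) that unfolding feasible_def by blast
  have val: "0 \<le> ttime I i" "0 \<le> ulim I i" "0 \<le> ptime I i" "ptime I i \<le> ulim I i"
    if "i < njobs I" for i
    using assms(1) that unfolding valid_instance_def by blast+
  have dur: "0 \<le> duration I x" if "x \<in> dom S" for x
    using val job[OF that] by (cases x) auto
  have fin_by: "the (S x) + duration I x \<le> ?C (job x)" if x: "x \<in> dom S" for x
  proof -
    define j where "j = job x"
    have x_in: "x \<in> {y \<in> dom S. job y = j}" and j: "j < njobs I"
      using x job[OF x] unfolding j_def by auto
    from tasks[OF j] show ?thesis
    proof
      assume *: "{y \<in> dom S. job y = j} = {Untested j}"
      have "Exec j \<notin> {y \<in> dom S. job y = j}" unfolding * by simp
      then have "Exec j \<notin> dom S" by simp
      then have "S (Exec j) = None" by blast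
      moreover have "x = Untested j"
        using x_in unfolding * by simp
      ultimately show ?thesis
        by (simp add: completion_def)
    next
      assume *: "{y \<in> dom S. job y = j} = {Test j, Exec j}"
      have "Test j \<in> {y \<in> dom S. job y = j}" "Exec j \<in> {y \<in> dom S. job y = j}"
        unfolding * by simp_all
      then have "Test j \<in> dom S" "Exec j \<in> dom S"
        by simp_all
      moreover from this obtain s where "S (Exec j) = Some s" by blast
      moreover have "x = Test j \<or> x = Exec j"
        using x_in unfolding * by simp
      ultimately show ?thesis
        using prec[of j] val(3)[OF j] by (auto simp: completion_def)
    qed
  qed
  have "finite {x. job x < njobs I}"
  proof (rule finite_subset)
    show "{x. job x < njobs I}
      \<subseteq> Test ` {..<njobs I} \<union> Exec ` {..<njobs I} \<union> Untested ` {..<njobs I}"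
    proof
      fix x assume "x \<in> {x. job x < njobs I}"
      then show "x \<in> Test ` {..<njobs I} \<union> Exec ` {..<njobs I} \<union> Untested ` {..<njobs I}"
        by (cases x) auto
    qed
  qed auto
  then have fX: "finite X"
    by (rule rev_finite_subset) (use job in \<open>auto simp: X_def\<close>)
  have "opt_time I i \<le> (\<Sum>x\<in>{x \<in> X. job x = i}. duration I x)" if "i \<in> J" for i
  proof -
    have i: "i < njobs I" and *: "{x \<in> X. job x = i} = {x \<in> dom S. job x = i}"
      using that unfolding X_def J_def by auto
    from tasks[OF i] show ?thesis
      unfolding * opt_time_def by (elim disjE ssubst) simp_all
  qed
  then have "sum (opt_time I) J \<le> (\<Sum>i\<in>J. \<Sum>x\<in>{x \<in> X. job x = i}. duration I x)"
    by (rule sum_mono)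
  also have "\<dots> = sum (duration I) X"
    using fX job by (intro sum.group) (auto simp: J_def X_def)
  also have "\<dots> \<le> ?C j"
  proof (rule sum_disjoint_intervals_le[where s = "\<lambda>x. the (S x)"])
    show "the (S x) + duration I x \<le> ?C j" if "x \<in> X" for x
      using that fin_by[of x] unfolding X_def by auto
    show "the (S x) + duration I x \<le> the (S y) \<or> the (S y) + duration I y \<le> the (S x)"
      if "x \<in> X" "y \<in> X" "x \<noteq> y" for x y
      using that assms(2) unfolding X_def feasible_def by blast
  qed (use fX start dur completion_nonneg[OF assms] in \<open>auto simp: X_def\<close>)
  also have "sum (opt_time I) J =
      (\<Sum>i<njobs I. if ?C i \<le> ?C j then opt_time I i else 0)"
    unfolding J_def by (simp add: sum.If_cases Int_def)
  finally show ?thesis .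
qed

section \<open>The order of tasks in a run of SORT\<close>

text \<open>\<open>before xs x y\<close>: \<open>x\<close> occurs in \<open>xs\<close>, and no occurrence of \<open>y \<noteq> x\<close> precedes it.\<close>

fun before :: "'a list \<Rightarrow> 'a \<Rightarrow> 'a \<Rightarrow> bool" where
  "before [] x y \<longleftrightarrow> False"
| "before (z # zs) x y \<longleftrightarrow> z = x \<or> z \<noteq> y \<and> before zs x y"

lemma before_total: "x \<in> set xs \<Longrightarrow> before xs x y \<or> before xs y x"
  by (induction xs) auto

lemma before_antisym: "before xs x y \<Longrightarrow> before xs y x \<Longrightarrow> x = y"
  by (induction xs) auto

lemma before_trans: "before xs x y \<Longrightarrow> before xs y z \<Longrightarrow> before xs x z"
  by (induction xs) auto

text \<open>There is no idle time. Since \<open>before xs y y\<close> holds for \<open>y\<close> in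
  \<open>xs\<close>, the sum includes the duration of \<open>y\<close> itself and so gives its end,
  not its start.\<close>

lemma seq_schedule_end:
  assumes "distinct xs" "y \<in> set xs"
  shows "the (seq_schedule I s xs y) + duration I y
    = s + (\<Sum>x\<in>set xs. if before xs x y then duration I x else 0)"
  using assms
proof (induction xs arbitrary: s)
  case (Cons z zs)
  have *: "(\<Sum>x\<in>set zs. if before (z # zs) x y then duration I x else 0)
    = (if z = y then 0 else \<Sum>x\<in>set zs. if before zs x y then duration I x else 0)"
    using Cons.prems by (auto intro!: sum.cong sum.neutral)
  show ?case
  proof (cases "z = y")
    case True
    with Cons.prems * show ?thesis by simp
  next
    case False
    with Cons.prems Cons.IH[of "s + duration I z"] * show ?thesis by simp
  qed
qed simp

text \<open>The third assumption ensures that \<open>y\<close> is in the queue when \<open>x\<close>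
  is extracted: it is there from the start, or it is an execution task whose test was extracted
  before \<open>x\<close>. The second alternative turns into the first once the induction passes
  that test.\<close>

lemma sort_run_before_weight_le:
  assumes "sort_run \<beta> I Q xs" "before xs x y"
    and "y \<in> Q \<or> (\<exists>j. y = Exec j \<and> x \<noteq> Test j \<and> before xs (Test j) x)"
  shows "weight \<beta> I x \<le> weight \<beta> I y"
  using assms
proof (induction rule: sort_run.induct)
  case (take_min z Q xs)
  show ?case
  proof (cases "z = x")
    case True
    with take_min show ?thesis by auto
  next
    case False
    show ?thesis
      by (rule take_min.IH) (use False take_min.prems in auto)
  qed
qed simp

lemma sort_run_test_before_exec:
  assumes "sort_run \<beta> I Q xs" "Test j \<in> Q" "Exec j \<notin> Q"
  shows "before xs (Test j) (Exec j)"
  using assms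
proof (induction rule: sort_run.induct)
  case (take_min z Q xs)
  show ?case
  proof (cases "z = Test j")
    case False
    have "before xs (Test j) (Exec j)"
      by (rule take_min.IH) (use False take_min in \<open>cases z; auto\<close>)+
    with take_min show ?thesis by auto
  qed simp
qed simp

section \<open>Splitting the cost of a run into pairwise delays\<close>

text \<open>A termwise comparison would fail, because two schedules may order the same pair
  differently. Adding each double sum to its transpose doubles it and makes the comparison of
  unordered pairs sufficient.\<close>

lemma sum_sum_le_if_symmetric_le:
  fixes f g :: "'a \<Rightarrow> 'a \<Rightarrow> 'b::linordered_field"
  assumes "\<And>i j. i \<in> A \<Longrightarrow> j \<in> A \<Longrightarrow> f i j + f j i \<le> g i j + g j i"
  shows "(\<Sum>j\<in>A. \<Sum>i\<in>A. f i j) \<le> (\<Sum>j\<in>A. \<Sum>i\<in>A. g i j)"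
proof -
  have double: "(\<Sum>j\<in>A. \<Sum>i\<in>A. h i j + h j i) = 2 * (\<Sum>j\<in>A. \<Sum>i\<in>A. h i j)" for h :: "'a \<Rightarrow> 'a \<Rightarrow> 'b"
    using sum.swap[of "\<lambda>i j. h i j" A A] by (simp add: sum.distrib)
  have "(\<Sum>j\<in>A. \<Sum>i\<in>A. f i j + f j i) \<le> (\<Sum>j\<in>A. \<Sum>i\<in>A. g i j + g j i)"
    using assms by (intro sum_mono) auto
  then show ?thesis unfolding double by simp
qed

definition sort_tasks :: "real \<Rightarrow> sched_instance \<Rightarrow> nat \<Rightarrow> task set" where
  "sort_tasks \<alpha> I j = (if \<alpha> * ttime I j \<le> ulim I j then {Test j, Exec j} else {Untested j})"

definition final_task :: "real \<Rightarrow> sched_instance \<Rightarrow> nat \<Rightarrow> task" where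
  "final_task \<alpha> I j = (if \<alpha> * ttime I j \<le> ulim I j then Exec j else Untested j)"

text \<open>The share of job \<open>i\<close> in the completion time of job \<open>j\<close>. In a
  run, \<open>delay \<alpha> I xs j j\<close> is the whole processing of \<open>j\<close>, including
  its final task.\<close>

definition delay :: "real \<Rightarrow> sched_instance \<Rightarrow> task list \<Rightarrow> nat \<Rightarrow> nat \<Rightarrow> real" where
  "delay \<alpha> I xs i j =
     (\<Sum>x\<in>sort_tasks \<alpha> I i. if before xs x (final_task \<alpha> I j) then duration I x else 0)"

locale SORT_run =
  fixes \<alpha> \<beta> :: real and I :: sched_instance and xs :: "task list"
  assumes \<alpha>_ge_1: "1 \<le> \<alpha>" and \<beta>_ge_1: "1 \<le> \<beta>"
    and valid: "valid_instance I"
    and run: "sort_run \<beta> I (init_queue \<alpha> I) xs"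
begin

abbreviation "t \<equiv> ttime I"
abbreviation "u \<equiv> ulim I"
abbreviation "p \<equiv> ptime I"
abbreviation "q \<equiv> opt_time I"
abbreviation "c \<equiv> sort_bound \<alpha> \<beta>"
abbreviation "tested j \<equiv> \<alpha> * t j \<le> u j"

lemma init_queue_iff:
  "Test j \<in> init_queue \<alpha> I \<longleftrightarrow> j < njobs I \<and> tested j"
  "Untested j \<in> init_queue \<alpha> I \<longleftrightarrow> j < njobs I \<and> \<not> tested j"
  "Exec j \<notin> init_queue \<alpha> I"
  unfolding init_queue_def by auto

lemma distinct_xs: "distinct xs"
  and set_xs: "set xs = init_queue \<alpha> I \<union> Exec ` {j. Test j \<in> init_queue \<alpha> I}"
  using sort_run_tasks[OF run] init_queue_iff by auto

lemma in_set_xs_iff: "x \<in> set xs \<longleftrightarrow> job x < njobs I \<and> x \<in> sort_tasks \<alpha> I (job x)"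
  unfolding set_xs sort_tasks_def by (cases x) (auto simp: init_queue_iff)

lemma completion_eq_sum_delay:
  assumes "j < njobs I"
  shows "completion I (seq_schedule I 0 xs) j = (\<Sum>i<njobs I. delay \<alpha> I xs i j)"
proof -
  let ?y = "final_task \<alpha> I j"
  have y: "?y \<in> set xs"
    using assms by (simp add: in_set_xs_iff final_task_def sort_tasks_def)
  have "completion I (seq_schedule I 0 xs) j = the (seq_schedule I 0 xs ?y) + duration I ?y"
  proof (cases "tested j")
    case True
    then have "Exec j \<in> dom (seq_schedule I 0 xs)"
      using y by (simp add: dom_seq_schedule final_task_def)
    with True show ?thesis
      by (auto simp: completion_def final_task_def)
  next
    case False
    then have "Exec j \<notin> dom (seq_schedule I 0 xs)"
      by (simp add: dom_seq_schedule in_set_xs_iff sort_tasks_def)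
    then have "seq_schedule I 0 xs (Exec j) = None" by blast
    with False show ?thesis
      by (simp add: completion_def final_task_def)
  qed
  also have "\<dots> = (\<Sum>x\<in>set xs. if before xs x ?y then duration I x else 0)"
    using seq_schedule_end[OF distinct_xs y, of I 0] by simp
  also have "\<dots> = (\<Sum>i<njobs I. \<Sum>x\<in>{x \<in> set xs. job x = i}.
      if before xs x ?y then duration I x else 0)"
    by (rule sum.group[symmetric]) (auto simp: in_set_xs_iff)
  also have "\<dots> = (\<Sum>i<njobs I. delay \<alpha> I xs i j)"
  proof (rule sum.cong)
    fix i assume "i \<in> {..<njobs I}"
    then have "{x \<in> set xs. job x = i} = sort_tasks \<alpha> I i"
      by (auto simp: in_set_xs_iff sort_tasks_def)
    then show "(\<Sum>x\<in>{x \<in> set xs. job x = i}. if before xs x ?y then duration I x else 0)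
        = delay \<alpha> I xs i j"
      unfolding delay_def by simp
  qed simp
  finally show ?thesis .
qed

section \<open>Estimates of task lengths by the optimal time of a job\<close>

lemma valid_job:
  assumes "j < njobs I"
  shows "0 \<le> t j" "0 \<le> u j" "0 \<le> p j" "p j \<le> u j" "0 \<le> q j"
  using assms valid unfolding valid_instance_def opt_time_def by auto

lemma bound_ge:
  "\<alpha> * (1 + 1 / \<beta>) \<le> c" "1 + 1 / \<alpha> + 1 / \<beta> \<le> c" "1 + \<beta> \<le> c" "2 \<le> c" "1 + 2 / \<alpha> \<le> c"
  unfolding sort_bound_def by simp_all

text \<open>The entries of the maximum, in their original order, multiplied out so that linear
  arithmetic can use them.\<close>

lemma mult_bound_ge:
  assumes "0 \<le> v"
  shows "\<alpha> * v + \<alpha> * (v / \<beta>) \<le> c * v" "v + v / \<alpha> + v / \<beta> \<le> c * v" "v + \<beta> * v \<le> c * v"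
    "2 * v \<le> c * v" "v + 2 * (v / \<alpha>) \<le> c * v"
  using bound_ge[THEN mult_right_mono[OF _ assms]] by (simp_all add: algebra_simps)

text \<open>An untested job has \<open>u j < \<alpha> * t j\<close>, so both \<open>u j\<close> and
  \<open>t j + p j\<close> are at least \<open>u j / \<alpha>\<close>.\<close>

lemma untested_le: "u j \<le> \<alpha> * q j" if "j < njobs I" "\<not> tested j"
proof -
  have "u j \<le> \<alpha> * u j" "p j \<le> \<alpha> * p j"
    using valid_job[OF that(1)] \<alpha>_ge_1 by (simp_all add: mult_le_cancel_right1 mult_le_cancel_left1)
  with that valid_job[OF that(1)] show ?thesis
    by (simp add: opt_time_def min_def algebra_simps)
qed

lemma tested_le:
  assumes "j < njobs I" "tested j"
  shows "t j \<le> q j" "p j \<le> q j" "t j \<le> u j / \<alpha>"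
proof -
  have "t j \<le> \<alpha> * t j"
    using valid_job[OF assms(1)] \<alpha>_ge_1 by (simp add: mult_le_cancel_right1)
  with assms valid_job[OF assms(1)] \<alpha>_ge_1
  show "t j \<le> q j" "p j \<le> q j" "t j \<le> u j / \<alpha>"
    by (auto simp: opt_time_def field_simps)
qed

lemma le_mult_opt_time:
  assumes "x \<le> c * u j" "x \<le> c * (t j + p j)"
  shows "x \<le> c * q j"
  using assms unfolding opt_time_def by (auto simp: min_def)

text \<open>If \<open>q j\<close> is \<open>u j\<close>, then
  \<open>t j \<le> u j / \<alpha>\<close> and \<open>p j \<le> u j\<close> lead to the second entry
  of the maximum; if it is \<open>t j + p j\<close>, then \<open>2 \<le> c\<close> suffices.\<close>

lemma tested_sum_le:
  assumes "j < njobs I" "tested j"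
  shows "t j + p j \<le> c * q j"
proof (rule le_mult_opt_time)
  note v = valid_job[OF assms(1)]
  have "0 \<le> u j / \<beta>" using v \<beta>_ge_1 by simp
  with mult_bound_ge(2)[OF v(2)] tested_le(3)[OF assms] v show "t j + p j \<le> c * u j"
    by linarith
  show "t j + p j \<le> c * (t j + p j)"
    using v by (intro order_trans[OF _ mult_bound_ge(4)]) simp_all
qed

text \<open>The first entry of the maximum. The extra \<open>u j / \<beta>\<close> leaves room for
  the test of another job that was extracted before \<open>Untested j\<close>.\<close>

lemma untested_mult_le:
  assumes "j < njobs I" "\<not> tested j"
  shows "u j + u j / \<beta> \<le> c * q j"
proof -
  have "u j * (1 + 1 / \<beta>) \<le> \<alpha> * q j * (1 + 1 / \<beta>)"
    using untested_le[OF assms] \<beta>_ge_1 by (intro mult_right_mono) auto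
  also have "\<dots> \<le> c * q j"
    using mult_bound_ge(1)[OF valid_job(5)[OF assms(1)]] by (simp add: algebra_simps)
  finally show ?thesis by (simp add: algebra_simps)
qed

lemma delay_self:
  assumes "j < njobs I"
  shows "delay \<alpha> I xs j j \<le> c * q j"
proof (cases "tested j")
  case True
  then show ?thesis
    using tested_sum_le[OF assms True] valid_job[OF assms]
    unfolding delay_def sort_tasks_def final_task_def by auto
next
  case False
  have "0 \<le> u j / \<beta>" using valid_job[OF assms] \<beta>_ge_1 by simp
  with False untested_mult_le[OF assms False] valid_job[OF assms] show ?thesis
    unfolding delay_def sort_tasks_def final_task_def by auto
qed

section \<open>Mutual delay of two jobs, by the order of their tasks\<close>

lemma in_xs:
  assumes "j < njobs I"
  shows "tested j \<Longrightarrow> Test j \<in> set xs" "tested j \<Longrightarrow> Exec j \<in> set xs"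
    "\<not> tested j \<Longrightarrow> Untested j \<in> set xs"
  using assms by (simp_all add: in_set_xs_iff sort_tasks_def)

lemma before_init_weight_le:
  assumes "before xs x y" "y \<in> init_queue \<alpha> I"
  shows "weight \<beta> I x \<le> weight \<beta> I y"
  using sort_run_before_weight_le[OF run] assms by blast

lemma before_exec_weight_le:
  assumes "before xs (Test j) x" "x \<noteq> Test j" "before xs x (Exec j)"
  shows "weight \<beta> I x \<le> p j"
  using sort_run_before_weight_le[OF run assms(3)] assms by auto

lemma test_before_exec:
  assumes "j < njobs I" "tested j"
  shows "before xs (Test j) (Exec j)"
  using sort_run_test_before_exec[OF run] assms init_queue_iff by blast

text \<open>Only the earlier job delays the other, and \<open>u i \<le> u j\<close> lets its length
  be charged to either job.\<close>

lemma delay_untested_untested: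
  assumes ij: "i < njobs I" "j < njobs I" "i \<noteq> j" "\<not> tested i" "\<not> tested j"
    and bef: "before xs (Untested i) (Untested j)"
  shows "delay \<alpha> I xs i j + delay \<alpha> I xs j i \<le> c * min (q i) (q j)"
proof -
  have "\<not> before xs (Untested j) (Untested i)"
    using bef ij before_antisym by fastforce
  then have "delay \<alpha> I xs i j + delay \<alpha> I xs j i = u i"
    using ij bef by (simp add: delay_def sort_tasks_def final_task_def)
  moreover have "u i \<le> u j"
    using before_init_weight_le[OF bef] ij by (simp add: init_queue_iff)
  moreover have "0 \<le> u i / \<beta>" "0 \<le> u j / \<beta>"
    using valid_job ij \<beta>_ge_1 by simp_all
  ultimately show ?thesis
    using untested_mult_le[OF ij(1,4)] untested_mult_le[OF ij(2,5)] by (simp add: min_def)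
qed

text \<open>The cases are the three positions of \<open>Untested i\<close> relative to the test and
  the execution of \<open>j\<close>. Each case bounds the delay by \<open>c * q i\<close> and by
  \<open>c * q j\<close> separately.\<close>

lemma delay_untested_tested:
  assumes ij: "i < njobs I" "j < njobs I" "\<not> tested i" "tested j"
  shows "delay \<alpha> I xs i j + delay \<alpha> I xs j i \<le> c * min (q i) (q j)"
proof -
  note vi = valid_job[OF ij(1)] and vj = valid_job[OF ij(2)]
  have neq: "i \<noteq> j" using ij by auto
  have ui: "0 \<le> u i / \<beta>" using vi \<beta>_ge_1 by simp
  note bi = untested_mult_le[OF ij(1,3)]
  have TE: "before xs (Test j) (Exec j)" using test_before_exec ij by blast
  have delay_eq: "delay \<alpha> I xs i j + delay \<alpha> I xs j i =
    (if before xs (Untested i) (Exec j) then u i else 0) +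
    ((if before xs (Test j) (Untested i) then t j else 0) +
     (if before xs (Exec j) (Untested i) then p j else 0))"
    using ij by (simp add: delay_def sort_tasks_def final_task_def)
  consider "before xs (Untested i) (Test j)"
    | "before xs (Test j) (Untested i)" "before xs (Untested i) (Exec j)"
    | "before xs (Exec j) (Untested i)"
    using before_total in_xs ij by metis
  then show ?thesis
  proof cases
    case 1
    have "before xs (Untested i) (Exec j)"
      using before_trans 1 TE by metis
    then have "delay \<alpha> I xs i j + delay \<alpha> I xs j i = u i"
      using delay_eq 1 before_antisym by fastforce
    moreover have "u i \<le> \<beta> * t j"
      using before_init_weight_le[OF 1] ij by (simp add: init_queue_iff)
    moreover have "\<beta> * t j \<le> \<beta> * q j"
      using tested_le[OF ij(2,4)] \<beta>_ge_1 by (intro mult_left_mono) auto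
    moreover have "\<beta> * q j \<le> c * q j"
      using mult_bound_ge(3)[OF vj(5)] vj(5) by linarith
    ultimately show ?thesis
      using bi ui by (simp add: min_def)
  next
    case 2
    then have "delay \<alpha> I xs i j + delay \<alpha> I xs j i = t j + u i"
      using delay_eq before_antisym by fastforce
    moreover have "\<beta> * t j \<le> u i"
      using before_init_weight_le[OF 2(1)] ij by (simp add: init_queue_iff)
    then have "t j \<le> u i / \<beta>" using \<beta>_ge_1 by (simp add: field_simps)
    \<comment> \<open>\<open>Exec j\<close> is already queued when \<open>Untested i\<close> is
      extracted.\<close>
    moreover have "u i \<le> p j"
      using before_exec_weight_le[OF 2(1) _ 2(2)] by simp
    then have "u i \<le> q j" using tested_le[OF ij(2,4)] by simp
    then have "t j + u i \<le> 2 * q j" using tested_le[OF ij(2,4)] by simp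
    ultimately show ?thesis
      using bi mult_bound_ge(4)[OF vj(5)] by (simp add: min_def)
  next
    case 3
    then have T: "before xs (Test j) (Untested i)"
      using before_trans TE by metis
    then have "delay \<alpha> I xs i j + delay \<alpha> I xs j i = t j + p j"
      using 3 delay_eq before_antisym by fastforce
    moreover have "\<beta> * t j \<le> u i"
      using before_init_weight_le[OF T] ij by (simp add: init_queue_iff)
    then have "t j \<le> u i / \<beta>" using \<beta>_ge_1 by (simp add: field_simps)
    moreover have "p j \<le> u i"
      using before_init_weight_le[OF 3] ij by (simp add: init_queue_iff)
    ultimately show ?thesis
      using bi tested_sum_le[OF ij(2,4)] by (simp add: min_def)
  qed
qed

text \<open>With \<open>Test i\<close> first, \<open>t i \<le> t j\<close>. Either \<open>i\<close>
  is finished before \<open>j\<close> is tested, for a delay of \<open>t i + p i\<close>, or both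
  tests precede \<open>Exec i\<close> and the delay is both tests plus the shorter
  execution.\<close>

lemma delay_tested_tested:
  assumes ij: "i < njobs I" "j < njobs I" "i \<noteq> j" "tested i" "tested j"
    and TT: "before xs (Test i) (Test j)"
  shows "delay \<alpha> I xs i j + delay \<alpha> I xs j i \<le> c * min (q i) (q j)"
proof -
  note vi = valid_job[OF ij(1)] and vj = valid_job[OF ij(2)]
  note ti = tested_le[OF ij(1,4)] and tj = tested_le[OF ij(2,5)]
  have TE: "before xs (Test i) (Exec i)" "before xs (Test j) (Exec j)"
    using test_before_exec ij by blast+
  then have TiEj: "before xs (Test i) (Exec j)"
    using before_trans TT by metis
  have "\<beta> * t i \<le> \<beta> * t j"
    using before_init_weight_le[OF TT] ij by (simp add: init_queue_iff)
  then have tij: "t i \<le> t j" using \<beta>_ge_1 by simp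
  have delay_eq: "delay \<alpha> I xs i j + delay \<alpha> I xs j i =
    t i + (if before xs (Exec i) (Exec j) then p i else 0) +
    ((if before xs (Test j) (Exec i) then t j else 0) +
     (if before xs (Exec j) (Exec i) then p j else 0))"
    using ij TiEj by (simp add: delay_def sort_tasks_def final_task_def)
  show ?thesis
  proof (cases "before xs (Exec i) (Test j)")
    case True
    have EE: "before xs (Exec i) (Exec j)"
      using before_trans True TE by metis
    then have delay_eq': "delay \<alpha> I xs i j + delay \<alpha> I xs j i = t i + p i"
      using delay_eq True ij before_antisym by fastforce
    have "p i \<le> \<beta> * t j"
      using before_init_weight_le[OF True] ij by (simp add: init_queue_iff)
    then have "t i + p i \<le> t j + \<beta> * t j" using tij by simp
    also have "\<dots> \<le> q j + \<beta> * q j"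
      using tj(1) \<beta>_ge_1 by (intro add_mono mult_left_mono) auto
    also have "\<dots> \<le> c * q j" by (rule mult_bound_ge(3)[OF vj(5)])
    finally show ?thesis
      using tested_sum_le[OF ij(1,4)] delay_eq' by (simp add: min_def)
  next
    case False
    then have TjEi: "before xs (Test j) (Exec i)"
      using before_total in_xs ij by metis
    \<comment> \<open>\<open>Test j\<close> was preferred to the already queued
      \<open>Exec i\<close>.\<close>
    have "\<beta> * t j \<le> p i"
      using before_exec_weight_le[OF TT _ TjEi] ij by simp
    then have tj_pi: "t j \<le> p i / \<beta>" using \<beta>_ge_1 by (simp add: field_simps)
    also have "\<dots> \<le> u i / \<beta>" using vi \<beta>_ge_1 by (intro divide_right_mono) auto
    finally have tj_ui: "t j \<le> u i / \<beta>" .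
    have tj_pi': "t j \<le> p i"
      using tj_pi vi \<beta>_ge_1 by (smt (verit) div_by_1 frac_le)
    \<comment> \<open>Whichever execution comes first, the other one is already in the queue at that
      moment, so the first is the shorter.\<close>
    define m where "m = min (p i) (p j)"
    have m: "delay \<alpha> I xs i j + delay \<alpha> I xs j i = t i + t j + m"
    proof (cases "before xs (Exec i) (Exec j)")
      case True
      have "p i \<le> p j"
        using before_exec_weight_le[OF TjEi _ True] by simp
      moreover have "\<not> before xs (Exec j) (Exec i)"
        using True ij before_antisym by fastforce
      ultimately show ?thesis
        using delay_eq True TjEi by (simp add: m_def)
    next
      case False
      then have EE: "before xs (Exec j) (Exec i)"
        using before_total in_xs ij by metis
      have "p j \<le> p i"
        using before_exec_weight_le[OF TiEj _ EE] by simp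
      then show ?thesis
        using delay_eq False EE TjEi by (simp add: m_def)
    qed
    have mle: "m \<le> p i" "m \<le> p j" unfolding m_def by simp_all
    have "t i + t j + m \<le> c * q i"
    proof (rule le_mult_opt_time)
      \<comment> \<open>Second entry of the maximum: the three terms are at most
        \<open>u i / \<alpha>\<close>, \<open>u i / \<beta>\<close> and \<open>u i\<close>.\<close>
      show "t i + t j + m \<le> c * u i"
        using mult_bound_ge(2)[OF vi(2)] ti(3) tj_ui mle vi(4) by linarith
      show "t i + t j + m \<le> c * (t i + p i)"
        using tj_pi' mle vi by (intro order_trans[OF _ mult_bound_ge(4)]) simp_all
    qed
    moreover have "t i + t j + m \<le> c * q j"
    proof (rule le_mult_opt_time)
      \<comment> \<open>Fifth entry of the maximum: both tests are at most
        \<open>u j / \<alpha>\<close>.\<close>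
      show "t i + t j + m \<le> c * u j"
        using mult_bound_ge(5)[OF vj(2)] tj(3) tij mle vj(4) by linarith
      show "t i + t j + m \<le> c * (t j + p j)"
        using tij mle vj by (intro order_trans[OF _ mult_bound_ge(4)]) simp_all
    qed
    ultimately show ?thesis unfolding m by (simp add: min_def)
  qed
qed

lemma delay_pair:
  assumes "i < njobs I" "j < njobs I" "i \<noteq> j"
  shows "delay \<alpha> I xs i j + delay \<alpha> I xs j i \<le> c * min (q i) (q j)"
proof (cases "tested i"; cases "tested j")
  assume "tested i" "tested j"
  moreover from this have "before xs (Test i) (Test j) \<or> before xs (Test j) (Test i)"
    using before_total in_xs assms by metis
  ultimately show ?thesis
    using delay_tested_tested[of i j] delay_tested_tested[of j i] assms
    by (auto simp: add.commute min.commute)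
next
  assume "\<not> tested i" "\<not> tested j"
  moreover from this have
    "before xs (Untested i) (Untested j) \<or> before xs (Untested j) (Untested i)"
    using before_total in_xs assms by metis
  ultimately show ?thesis
    using delay_untested_untested[of i j] delay_untested_untested[of j i] assms
    by (auto simp: add.commute min.commute)
qed (use delay_untested_tested[of i j] delay_untested_tested[of j i] assms in
  \<open>simp_all add: add.commute min.commute\<close>)

end

section \<open>Competitiveness for general parameters\<close>

theorem SORT_competitive:
  assumes "1 \<le> \<alpha>" "1 \<le> \<beta>"
  shows "competitive (SORT \<alpha> \<beta>) (sort_bound \<alpha> \<beta>)"
  unfolding competitive_def
proof (intro allI impI ballI)
  fix I S assume valid: "valid_instance I" and "S \<in> SORT \<alpha> \<beta> I"
  then obtain xs where S: "S = seq_schedule I 0 xs" and "sort_run \<beta> I (init_queue \<alpha> I) xs"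
    unfolding SORT_def by auto
  then interpret SORT_run \<alpha> \<beta> I xs
    using assms valid by unfold_locales
  have "0 < c" using bound_ge(4) by simp
  have "cost I S \<le> c * cost I S'" if feas: "feasible I S'" for S'
  proof -
    let ?C = "completion I S'"
    have "cost I S = (\<Sum>j<njobs I. \<Sum>i<njobs I. delay \<alpha> I xs i j)"
      unfolding cost_def S using completion_eq_sum_delay by simp
    \<comment> \<open>The non-strict comparison keeps the diagonal terms \<open>q j\<close>. On a
      tie both jobs of a pair are counted, which still gives at least the minimum.\<close>
    also have "\<dots> \<le> (\<Sum>j<njobs I. \<Sum>i<njobs I. c * (if ?C i \<le> ?C j then q i else 0))"
    proof (rule sum_sum_le_if_symmetric_le)
      fix i j assume "i \<in> {..<njobs I}" "j \<in> {..<njobs I}"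
      then have ij: "i < njobs I" "j < njobs I" by auto
      show "delay \<alpha> I xs i j + delay \<alpha> I xs j i
        \<le> c * (if ?C i \<le> ?C j then q i else 0) + c * (if ?C j \<le> ?C i then q j else 0)"
      proof (cases "i = j")
        case True
        with delay_self[OF ij(1)] show ?thesis by simp
      next
        case False
        have "min (q i) (q j)
            \<le> (if ?C i \<le> ?C j then q i else 0) + (if ?C j \<le> ?C i then q j else 0)"
          using valid_job(5)[OF ij(1)] valid_job(5)[OF ij(2)] by auto
        then have "c * min (q i) (q j) \<le>
            c * ((if ?C i \<le> ?C j then q i else 0) + (if ?C j \<le> ?C i then q j else 0))"
          using \<open>0 < c\<close> by simp
        with delay_pair[OF ij False] show ?thesis
          by (simp add: distrib_left)
      qed
    qed
    also have "\<dots> = c * (\<Sum>j<njobs I. \<Sum>i<njobs I. if ?C i \<le> ?C j then q i else 0)"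
      by (simp only: sum_distrib_left)
    also have "\<dots> \<le> c * cost I S'"
      unfolding cost_def using \<open>0 < c\<close> sum_opt_time_le_completion[OF valid feas]
      by (intro mult_left_mono sum_mono) auto
    finally show ?thesis .
  qed
  \<comment> \<open>The optimum is an infimum, so the bound against every feasible \<open>S'\<close>
    is read as a lower bound \<open>cost I S / c\<close> of all their costs.\<close>
  then have "cost I S / c \<le> opt_cost I"
    unfolding opt_cost_def using \<open>0 < c\<close> feasible_costs(1)[OF valid]
    by (intro cInf_greatest) (auto simp: field_simps)
  then show "cost I S \<le> c * opt_cost I"
    using \<open>0 < c\<close> by (simp add: field_simps)
qed

section \<open>Optimal choice of the parameters\<close>

text \<open>At this point all entries of the maximum except the constant \<open>2\<close>
  coincide.\<close>

lemma sort_bound_sqrt_2: "sort_bound (sqrt 2) (sqrt 2) = 1 + sqrt 2"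
proof -
  have inv: "1 / sqrt 2 = sqrt 2 / 2" "2 / sqrt 2 = sqrt 2"
    by (simp_all add: field_simps)
  have "sqrt 2 * (1 + 1 / sqrt 2) = 1 + sqrt 2"
    by (simp add: algebra_simps)
  then show ?thesis
    unfolding sort_bound_def inv by simp
qed

text \<open>Three entries suffice: \<open>1 + 2 / \<alpha>\<close> is large for small \<alpha>,
  \<open>1 + \<beta>\<close> for large \<beta>, and \<open>\<alpha> * (1 + 1 / \<beta>)\<close>,
  increasing in \<alpha> and decreasing in \<beta>, covers the remaining region.\<close>

lemma sort_bound_ge:
  assumes "1 \<le> \<alpha>" "1 \<le> \<beta>"
  shows "1 + sqrt 2 \<le> sort_bound \<alpha> \<beta>"
proof -
  consider "\<alpha> \<le> sqrt 2" | "sqrt 2 \<le> \<beta>" | "sqrt 2 \<le> \<alpha>" "\<beta> \<le> sqrt 2" by linarith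
  then show ?thesis
  proof cases
    case 1
    have "sqrt 2 = 2 / sqrt 2" by (simp add: field_simps)
    also have "\<dots> \<le> 2 / \<alpha>" using 1 assms by (intro divide_left_mono) auto
    finally have "1 + sqrt 2 \<le> 1 + 2 / \<alpha>" by simp
    also have "\<dots> \<le> sort_bound \<alpha> \<beta>" unfolding sort_bound_def by (rule Max_ge) auto
    finally show ?thesis .
  next
    case 2
    then have "1 + sqrt 2 \<le> 1 + \<beta>" by simp
    also have "\<dots> \<le> sort_bound \<alpha> \<beta>" unfolding sort_bound_def by (rule Max_ge) auto
    finally show ?thesis .
  next
    case 3
    have "1 + sqrt 2 = sqrt 2 * (1 + 1 / sqrt 2)" by (simp add: algebra_simps)
    also have "\<dots> \<le> \<alpha> * (1 + 1 / \<beta>)"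
      using 3 assms by (intro mult_mono add_left_mono divide_left_mono) auto
    also have "\<dots> \<le> sort_bound \<alpha> \<beta>" unfolding sort_bound_def by (rule Max_ge) auto
    finally show ?thesis .
  qed
qed

theorem corollary4:
  shows "competitive (SORT (sqrt 2) (sqrt 2)) (1 + sqrt 2) \<and>
    is_arg_min (\<lambda>(\<alpha>, \<beta>). sort_bound \<alpha> \<beta>) (\<lambda>(\<alpha>, \<beta>). 1 \<le> \<alpha> \<and> 1 \<le> \<beta>) (sqrt 2, sqrt 2)"
  using SORT_competitive[of "sqrt 2" "sqrt 2"] sort_bound_ge
  by (auto simp: is_arg_min_linorder sort_bound_sqrt_2)

end
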